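(* Let $K$ be a field, $m\geq 1$, and fix a graded admissible ordering on $\mathbb{N}^m$. Assume that $F=\{f_1,\dots,f_s\}\subseteq K[x_1,\dots,x_m]$ is a set of non-zero polynomials and $d\geq 1$ is a natural number such that $\deg(f_i)\leq d$ for $i=1,\dots,s$. Let $$\langle \mathrm{LT}(B_0)\rangle\subsetneq\langle \mathrm{LT}(B_1)\rangle\subsetneq\dots\subsetneq\langle \mathrm{LT}(B_r)\rangle$$ be the associated ascending chain of monomial ideals arising from Buchberger's algorithm applied to $F$, such that $B_r$ is the Gröbner basis of $\langle F\rangle$ returned by the algorithm. Then $r+1\leq\mathcal{B}(m,\phi)$, where $\phi:\mathbb{N}_1\to\mathbb{N}_1$ is the function $\phi(n)=3^{n}d$.
   Context: $\mathbb{N}=\{0,1,2,\dots\}$, $\mathbb{N}_1=\mathbb{N}\setminus\{0\}$; $\deg$ is total degree. Orderings. An admissible ordering $\preccurlyeq$ on $\mathbb{N}^m$ is a linear order with $\underline{0}\preccurlyeq\alpha$ for all $\alpha$, and such that $\alpha\preccurlyeq\beta$ implies $\alpha+\gamma\preccurlyeq\beta+\gamma$; it is graded if $\alpha\preccurlyeq\beta$ implies $|\alpha|\leq|\beta|$, where $|(a_1,\dots,a_m)|=a_1+\dots+a_m$. Identifying $\alpha$ with the monomial $\underline{x}^\alpha$, for a non-zero polynomial $f$ we write $\mathrm{lm}(f)$ for its leading monomial and $\mathrm{lt}(f)$ for its leading term (coefficient included). For a set $B$ of non-zero polynomials, $\mathrm{LT}(B)=\{\mathrm{lt}(b): b\in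 B\}$. Reductions. For a finite set $B=\{b_1,\dots,b_s\}$ of non-zero polynomials and a polynomial $f$, a reduction of $f$ modulo $B$, denoted $f_B$, is a polynomial $r$ produced by the multivariable division algorithm: $f=a_1b_1+\dots+a_sb_s+r$ for some polynomials $a_i$, where $\mathrm{lm}(f)$ is the greatest of the leading monomials of the non-zero polynomials among $a_1b_1,\dots,a_sb_s,r$ (for $f=0$ all are $0$), and no $\mathrm{lm}(b_i)$ divides any monomial in the support of $r$. $S$-polynomials. For non-zero $f,g$, with $\underline{x}^\alpha$ the least common multiple of $\mathrm{lm}(f)$ and $\mathrm{lm}(g)$, $S(f,g)=\frac{\underline{x}^\alpha}{\mathrm{lt}(f)}f-\frac{\underline{x}^\alpha}{\mathrm{lt}(g)}g$. Put $S_B=\{S(b_i,b_j)_B : b_i,b_j\in B\}\setminus\{0\}$ (one reduction chosen for each pair). Buchberger's algorithm. Put $B_0=F$ and $B_{i+1}=B_i\cup S_{B_i}$; stop at the first index $r$ with $B_{r+1}=B_r$ and return $B_r$, a Gröbner basis of $\langle F\rangle$. One has $\langle\mathrm{LT}(B_i)\rangle\subsetneq\langle\mathrm{LT}(B_{i+1})\rangle$ for $0\leq i<r$. Definition of $\mathcal{B}$. Let $\mathbb{F}$ be the set of all non-decreasing functions $\mathbb{N}_1\to\mathbb{N}_1$. For $f\in\mathbb{F}$ and $s\in\mathbb{N}$ let ${}^{s}f\in\mathbb{F}$ be given by ${}^{s}f(n)=f(s+n)$. The function $\mathcal{B}:\mathbb{N}_1\times\mathbb{F}\to\mathbb{N}$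 is defined by recursion on $m$. Put $\mathcal{B}(1,f)=f(1)+1$. For $m\geq 2$, assuming that $\mathcal{B}(m-1,\cdot)$ is defined, define functions $\mathcal{B}_m^k:\mathbb{F}\times\mathbb{N}^k\to\mathbb{N}$ for $k=m,m-1,\dots,0$ by backward recursion on $k$: (i) $\mathcal{B}_m^m(f,b_1,\dots,b_m)=(b_1+1)\cdots(b_m+1)$; (ii) for $0\leq k\leq m-1$, $f\in\mathbb{F}$ and $\beta\in\mathbb{N}^k$, let $g:\mathbb{N}_1\to\mathbb{N}_1$ be given by $g(1)=1$ and $g(n+1)=1+g(n)+\mathcal{B}_m^{k+1}\big({}^{g(n)}f,\beta,f(g(n))\big)$ for $n\geq 1$ (so $g\in\mathbb{F}$), and put $\mathcal{B}_m^k(f,\beta)=g\big(\mathcal{B}(m-1,f\circ g)+1\big)$. Finally, $\mathcal{B}(m,f)=\mathcal{B}_m^0(f)$ (for $k=0$ the tuple $\beta$ is empty). *)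

theory Defs
  imports
    "HOL-Library.Poly_Mapping"
    "HOL-Analysis.Finite_Cartesian_Product"
begin

text \<open>
  The polynomial ring \<open>K[x\<^sub>1,\<dots>,x\<^sub>m]\<close> is the convolution ring of finitely supported functions
  from \<open>\<nat>\<^sup>m\<close> to \<open>K\<close>, where \<open>\<nat>\<^sup>m\<close> is \<open>nat ^ 'n\<close> and \<open>m = CARD('n)\<close> (so \<open>m \<ge> 1\<close>).
  An exponent vector \<open>\<alpha>\<close> stands for the monomial \<open>x\<^sup>\<alpha>\<close>, and the support of \<open>f\<close> is \<open>keys f\<close>.
\<close>

type_synonym 'n monom = "nat ^ 'n"
type_synonym ('n, 'a) mpoly = "(nat ^ 'n) \<Rightarrow>\<^sub>0 'a"

subsection \<open>Orderings and leading terms\<close>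

definition monom_deg :: "'n::finite monom \<Rightarrow> nat" where
  "monom_deg \<alpha> = (\<Sum>i\<in>UNIV. \<alpha> $ i)"

text \<open>An ordering is given as a relation \<open>le\<close>, with \<open>(\<alpha>, \<beta>) \<in> le\<close> meaning \<open>\<alpha> \<preceq> \<beta>\<close>.\<close>

definition admissible :: "'n::finite monom rel \<Rightarrow> bool" where
  "admissible le \<longleftrightarrow>
     linear_order le \<and>
     (\<forall>\<alpha>. (0, \<alpha>) \<in> le) \<and>
     (\<forall>\<alpha> \<beta> \<gamma>. (\<alpha>, \<beta>) \<in> le \<longrightarrow> (\<alpha> + \<gamma>, \<beta> + \<gamma>) \<in> le)"

definition graded :: "'n::finite monom rel \<Rightarrow> bool" where
  "graded le \<longleftrightarrow> (\<forall>\<alpha> \<beta>. (\<alpha>, \<beta>) \<in> le \<longrightarrow> monom_deg \<alpha> \<le> monom_deg \<beta>)"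

text \<open>The following three are only meaningful for \<open>f \<noteq> 0\<close>.\<close>

definition total_degree :: "('n::finite, 'a::zero) mpoly \<Rightarrow> nat" where
  "total_degree f = Max (monom_deg ` Poly_Mapping.keys f)"

definition lm :: "'n::finite monom rel \<Rightarrow> ('n, 'a::zero) mpoly \<Rightarrow> 'n monom" where
  "lm le f = (THE \<alpha>. \<alpha> \<in> Poly_Mapping.keys f \<and> (\<forall>\<beta>\<in>Poly_Mapping.keys f. (\<beta>, \<alpha>) \<in> le))"

definition lt :: "'n::finite monom rel \<Rightarrow> ('n, 'a::zero) mpoly \<Rightarrow> ('n, 'a) mpoly" where
  "lt le f = Poly_Mapping.single (lm le f) (Poly_Mapping.lookup f (lm le f))"

definition LT :: "'n::finite monom rel \<Rightarrow> ('n, 'a::zero) mpoly set \<Rightarrow> ('n, 'a) mpoly set" where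
  "LT le B = lt le ` B"

definition ideal_gen :: "'r::comm_ring_1 set \<Rightarrow> 'r set" where
  "ideal_gen = module.span (*)"

lemma module_mult: "module ((*) :: 'r::comm_ring_1 \<Rightarrow> 'r \<Rightarrow> 'r)"
  by unfold_locales (simp_all add: algebra_simps)

lemma ideal_gen_explicit: "ideal_gen A = {(\<Sum>a\<in>T. c a * a) | T c. finite T \<and> T \<subseteq> A}"
  by (simp add: ideal_gen_def module.span_explicit[OF module_mult])

subsection \<open>Reductions and S-polynomials\<close>

definition monom_dvd :: "'n::finite monom \<Rightarrow> 'n monom \<Rightarrow> bool" where
  "monom_dvd \<alpha> \<beta> \<longleftrightarrow> (\<exists>\<gamma>. \<beta> = \<alpha> + \<gamma>)"

definition monom_lcm :: "'n::finite monom \<Rightarrow> 'n monom \<Rightarrow> 'n monom" where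
  "monom_lcm \<alpha> \<beta> = (\<chi> i. max (\<alpha> $ i) (\<beta> $ i))"

text \<open>
  Reductions are not unique, so this is a relation: \<open>r\<close> is a possible remainder of \<open>f\<close>.
\<close>

definition is_reduction ::
    "'n::finite monom rel \<Rightarrow> ('n, 'a::field) mpoly set \<Rightarrow> ('n, 'a) mpoly \<Rightarrow> ('n, 'a) mpoly \<Rightarrow> bool" where
  "is_reduction le B f r \<longleftrightarrow>
     (\<exists>a. f = (\<Sum>b\<in>B. a b * b) + r \<and>
          (let L = lm le ` (insert r ((\<lambda>b. a b * b) ` B) - {0})
           in if f = 0 then L = {} else lm le f \<in> L \<and> (\<forall>\<mu>\<in>L. (\<mu>, lm le f) \<in> le))) \<and>
     (\<forall>b\<in>B. \<forall>\<mu>\<in>Poly_Mapping.keys r. \<not> monom_dvd (lm le b) \<mu>)"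

text \<open>
  The factor \<open>x\<^sup>\<alpha> / lt f\<close> is the term with exponent \<open>\<alpha> - lm f\<close> (truncated subtraction is exact,
  because \<open>lm f\<close> divides \<open>x\<^sup>\<alpha>\<close>) and coefficient the inverse of the leading coefficient.
\<close>

definition spoly ::
    "'n::finite monom rel \<Rightarrow> ('n, 'a::field) mpoly \<Rightarrow> ('n, 'a) mpoly \<Rightarrow> ('n, 'a) mpoly" where
  "spoly le f g =
     (let \<alpha> = monom_lcm (lm le f) (lm le g);
          cofactor = (\<lambda>h. Poly_Mapping.single (\<alpha> - lm le h) (1 / Poly_Mapping.lookup h (lm le h)))
      in cofactor f * f - cofactor g * g)"

text \<open>\<open>S\<close> is a possible \<open>S\<^sub>B\<close>, with \<open>red b c\<close> the reduction chosen for the pair \<open>(b, c)\<close>.\<close>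

definition is_spoly_reductions ::
    "'n::finite monom rel \<Rightarrow> ('n, 'a::field) mpoly set \<Rightarrow> ('n, 'a) mpoly set \<Rightarrow> bool" where
  "is_spoly_reductions le B S \<longleftrightarrow>
     (\<exists>red. (\<forall>b\<in>B. \<forall>c\<in>B. is_reduction le B (spoly le b c) (red b c)) \<and>
            S = {red b c | b c. b \<in> B \<and> c \<in> B} - {0})"

text \<open>
  \<open>B 0, B 1, \<dots>, B r, B (r + 1)\<close> is a run of Buchberger's algorithm on \<open>F\<close> that stops at index \<open>r\<close>
  and returns \<open>B r\<close>; the values of \<open>B\<close> beyond \<open>r + 1\<close> are irrelevant.
\<close>

definition buchberger_run ::
    "'n::finite monom rel \<Rightarrow> ('n, 'a::field) mpoly set \<Rightarrow> (nat \<Rightarrow> ('n, 'a) mpoly set) \<Rightarrow> nat \<Rightarrow> bool" where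
  "buchberger_run le F B r \<longleftrightarrow>
     B 0 = F \<and>
     (\<forall>i\<le>r. \<exists>S. is_spoly_reductions le (B i) S \<and> B (i + 1) = B i \<union> S) \<and>
     B (r + 1) = B r \<and>
     (\<forall>i<r. B (i + 1) \<noteq> B i)"

subsection \<open>The bounding function\<close>

text \<open>
  Functions on the positive integers are represented by functions on \<open>nat\<close> whose value at \<open>0\<close> is
  never used.
\<close>

definition shift :: "nat \<Rightarrow> (nat \<Rightarrow> nat) \<Rightarrow> nat \<Rightarrow> nat" where
  "shift s f n = f (s + n)"

text \<open>
  The auxiliary function \<open>g\<close> of clause (ii), with \<open>H f' b\<close> in the role of
  \<open>\<B>\<^sub>m\<^sup>k\<^sup>+\<^sup>1(f', \<beta>, b)\<close>. The value at \<open>0\<close> is a dummy.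
\<close>

fun gseq :: "((nat \<Rightarrow> nat) \<Rightarrow> nat \<Rightarrow> nat) \<Rightarrow> (nat \<Rightarrow> nat) \<Rightarrow> nat \<Rightarrow> nat" where
  "gseq H f 0 = 0"
| "gseq H f (Suc n) =
     (if n = 0 then 1
      else 1 + gseq H f n + H (shift (gseq H f n) f) (f (gseq H f n)))"

text \<open>
  \<open>calB m f\<close> is \<open>\<B>(m, f)\<close> for \<open>m \<ge> 1\<close>, and \<open>calBk m k f \<beta>\<close> is \<open>\<B>\<^sub>m\<^sup>k(f, \<beta>)\<close> for \<open>m \<ge> 2\<close>, \<open>k \<le> m\<close>
  and a tuple \<open>\<beta>\<close> of length \<open>k\<close>.
\<close>

function (sequential)
  calB :: "nat \<Rightarrow> (nat \<Rightarrow> nat) \<Rightarrow> nat" and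
  calBk :: "nat \<Rightarrow> nat \<Rightarrow> (nat \<Rightarrow> nat) \<Rightarrow> nat list \<Rightarrow> nat"
where
  "calB m f = (if m \<le> 1 then f 1 + 1 else calBk m 0 f [])"
| "calBk m k f \<beta> =
     (if m \<le> k then (\<Prod>b\<leftarrow>\<beta>. b + 1)
      else let g = gseq (\<lambda>f' b. calBk m (k + 1) f' (\<beta> @ [b])) f
           in g (calB (m - 1) (f \<circ> g) + 1))"
  by pat_completeness auto
termination
  by (relation "measures [\<lambda>x. case x of Inl (m, _) \<Rightarrow> m | Inr (m, _) \<Rightarrow> m,
                          \<lambda>x. case x of Inl (m, _) \<Rightarrow> m + 1 | Inr (m, k, _) \<Rightarrow> m - k]") auto

declare calB.simps [simp del] calBk.simps [simp del]

end

theory Submission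
  imports Defs
begin

text \<open>
  The leading monomials of \<open>B i\<close> have degree at most \<open>2\<^sup>i d\<close>, because the ordering is graded and an
  lcm at most doubles degrees, so the run yields a strictly ascending chain of monomial ideals whose
  \<open>j\<close>-th member is generated by exponents bounded by \<open>f j\<close> with \<open>f j = 3\<^sup>j d\<close>. The length
  of such a chain is bounded by induction on the number of variables. Setting a variable \<open>v\<close> to \<open>1\<close> in
  the members with indices \<open>g 1, g 2, \<dots>\<close> gives an ascending chain in fewer variables, which must stall
  between some \<open>g n\<close> and \<open>g (n + 1)\<close>. In that range all new monomials have \<open>v\<close>-exponent below
  \<open>f (g n)\<close>, so a power of \<open>v\<close> may be added to all the ideals, and the gap between \<open>g n\<close> and
  \<open>g (n + 1)\<close> exceeds the bound for chains that contain one more pure power. Once pure powers of all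
  variables are present, only the finitely many monomials of a box are left.
\<close>

section \<open>Up-closed exponent sets and bounded chains\<close>

text \<open>Monomial ideals are encoded by their sets of exponents, as functions on an arbitrary type of
  variables; the number of variables then decreases by passing to a subset \<open>V\<close> of the type.\<close>

definition upset :: "('v \<Rightarrow> nat) set \<Rightarrow> ('v \<Rightarrow> nat) set" where
  "upset G = {\<beta>. \<exists>\<alpha>\<in>G. \<alpha> \<le> \<beta>}"

lemma upset_subset_iff: "upset A \<subseteq> upset B \<longleftrightarrow> A \<subseteq> upset B"
proof
  have "A \<subseteq> upset A" by (auto simp: upset_def)
  then show "upset A \<subseteq> upset B \<Longrightarrow> A \<subseteq> upset B" by blast
  assume sub: "A \<subseteq> upset B"
  show "upset A \<subseteq> upset B"
  proof
    fix \<gamma> assume "\<gamma> \<in> upset A"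
    then obtain \<alpha> where "\<alpha> \<in> A" "\<alpha> \<le> \<gamma>" by (auto simp: upset_def)
    moreover from this sub obtain \<beta> where "\<beta> \<in> B" "\<beta> \<le> \<alpha>" by (auto simp: upset_def)
    ultimately show "\<gamma> \<in> upset B" unfolding upset_def by (metis (mono_tags) mem_Collect_eq order_trans)
  qed
qed

lemma upset_insert: "upset (insert \<alpha> A) = upset {\<alpha>} \<union> upset A"
  by (auto simp: upset_def)

text \<open>Members are given by generating sets because only generators carry exponent bounds.
  Indices start at 1, like the arguments of the bounding function. The condition
  \<open>G 1 \<noteq> {}\<close> excludes the zero ideal, so that with a single variable and
  \<open>L \<ge> 1\<close> a power bounded by \<open>f 1\<close> is present from the start.\<close>

definition bounded_chain ::
    "'v set \<Rightarrow> (nat \<Rightarrow> nat) \<Rightarrow> nat \<Rightarrow> (nat \<Rightarrow> ('v \<Rightarrow> nat) set) \<Rightarrow> bool" where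
  "bounded_chain V f L G \<longleftrightarrow>
     (\<forall>j\<in>{1..L}. \<forall>\<alpha>\<in>G j. (\<forall>v. v \<notin> V \<longrightarrow> \<alpha> v = 0) \<and> (\<forall>v. \<alpha> v \<le> f j)) \<and>
     (\<forall>j\<in>{1..<L}. upset (G j) \<subset> upset (G (Suc j))) \<and> G 1 \<noteq> {}"

lemma bounded_chain_generator:
  assumes "bounded_chain V f L G" "1 \<le> j" "j \<le> L" "\<alpha> \<in> G j"
  shows "v \<notin> V \<Longrightarrow> \<alpha> v = 0" "\<alpha> v \<le> f j"
proof -
  have "j \<in> {1..L}" using assms(2,3) by simp
  then have "(\<forall>v. v \<notin> V \<longrightarrow> \<alpha> v = 0) \<and> (\<forall>v. \<alpha> v \<le> f j)"
    using conjunct1[OF assms(1)[unfolded bounded_chain_def]] assms(4) by blast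
  then show "v \<notin> V \<Longrightarrow> \<alpha> v = 0" "\<alpha> v \<le> f j" by simp_all
qed

lemma bounded_chain_mono:
  assumes "bounded_chain V f L G" "1 \<le> i" "i \<le> j" "j \<le> L"
  shows "upset (G i) \<subseteq> upset (G j)"
  using assms(3,4)
proof (induction j rule: dec_induct)
  case (step n)
  then have "upset (G n) \<subset> upset (G (Suc n))"
    using assms(1,2) by (auto simp: bounded_chain_def)
  with step show ?case by auto
qed simp

lemma bounded_chain_new:
  assumes "bounded_chain V f L G" "j \<in> {1..<L}"
  obtains \<gamma> where "\<gamma> \<in> G (Suc j)" "\<gamma> \<notin> upset (G j)"
proof -
  have "upset (G j) \<subset> upset (G (Suc j))"
    using assms unfolding bounded_chain_def by blast
  then have "\<not> G (Suc j) \<subseteq> upset (G j)" using upset_subset_iff by blast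
  with that show ?thesis by blast
qed

text \<open>The pure powers in \<open>G 1\<close> confine every new monomial to the box of exponents
  below \<open>b\<close>, and no monomial is new twice, so the steps of the chain inject into the
  box.\<close>

lemma bounded_chain_length_le_box:
  fixes V :: "'v set"
  assumes V: "finite V" "V \<noteq> {}" and ch: "bounded_chain V f L G"
    and b: "\<And>v. v \<in> V \<Longrightarrow> (\<lambda>_. 0)(v := b v) \<in> upset (G 1)"
  shows "L \<le> (\<Prod>v\<in>V. b v + 1)"
proof -
  have "\<exists>\<gamma>. \<gamma> \<in> G (Suc j) \<and> \<gamma> \<notin> upset (G j)" if "j \<in> {1..<L}" for j
    using bounded_chain_new[OF ch that] by blast
  then obtain \<gamma> where \<gamma>: "\<And>j. j \<in> {1..<L} \<Longrightarrow> \<gamma> j \<in> G (Suc j)"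
      "\<And>j. j \<in> {1..<L} \<Longrightarrow> \<gamma> j \<notin> upset (G j)"
    by metis
  have below: "\<gamma> j v < b v" if j: "j \<in> {1..<L}" and v: "v \<in> V" for j v
  proof (rule ccontr)
    assume "\<not> \<gamma> j v < b v"
    then have "(\<lambda>_. 0)(v := b v) \<le> \<gamma> j" by (auto simp: le_fun_def)
    then have "\<gamma> j \<in> upset (G 1)"
      using b[OF v] unfolding upset_def by (auto intro: order_trans)
    then show False
      using bounded_chain_mono[OF ch, of 1 j] \<gamma>(2)[OF j] j by auto
  qed
  have neq: "\<gamma> i \<noteq> \<gamma> j" if "i \<in> {1..<L}" "j \<in> {1..<L}" "i < j" for i j
  proof
    assume eq: "\<gamma> i = \<gamma> j"
    have "\<gamma> i \<in> upset (G (Suc i))" using \<gamma>(1)[OF that(1)] by (auto simp: upset_def)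
    then have "\<gamma> i \<in> upset (G j)"
      using bounded_chain_mono[OF ch, of "Suc i" j] that by auto
    then show False using eq \<gamma>(2)[OF that(2)] by simp
  qed
  have supp: "\<gamma> j v = 0" if "j \<in> {1..<L}" "v \<notin> V" for j v
    using ch \<gamma>(1)[OF that(1)] that unfolding bounded_chain_def by fastforce
  have inj: "inj_on (\<lambda>j. restrict (\<gamma> j) V) {1..<L}"
  proof (rule inj_onI)
    fix i j assume ij: "i \<in> {1..<L}" "j \<in> {1..<L}" and eq: "restrict (\<gamma> i) V = restrict (\<gamma> j) V"
    have "\<gamma> i v = \<gamma> j v" for v
      using fun_cong[OF eq, of v] supp[OF ij(1), of v] supp[OF ij(2), of v] by (cases "v \<in> V") auto
    then have "\<gamma> i = \<gamma> j" by auto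
    then show "i = j" using neq ij by (metis linorder_neqE_nat)
  qed
  let ?P = "PiE V (\<lambda>v. {..b v})"
  obtain v0 where v0: "v0 \<in> V" using V by auto
  have fin: "finite ?P" using V by (auto intro: finite_PiE)
  have sub: "(\<lambda>j. restrict (\<gamma> j) V) ` {1..<L} \<subseteq> ?P"
    using below by (auto intro: less_imp_le)
  \<comment> \<open>A chain of \<open>L\<close> members has only \<open>L - 1\<close> steps. The
    corner \<open>b\<close> of the closed box is not hit, since \<open>V\<close> has an element, and
    this makes up for the difference.\<close>
  have "restrict b V \<notin> (\<lambda>j. restrict (\<gamma> j) V) ` {1..<L}"
  proof
    assume "restrict b V \<in> (\<lambda>j. restrict (\<gamma> j) V) ` {1..<L}"
    then obtain j where j: "j \<in> {1..<L}" and e: "restrict b V = restrict (\<gamma> j) V" by blast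
    show False using fun_cong[OF e, of v0] v0 below[OF j v0] by simp
  qed
  moreover have "restrict b V \<in> ?P" by auto
  ultimately have "(\<lambda>j. restrict (\<gamma> j) V) ` {1..<L} \<subset> ?P" using sub by auto
  then have "card ((\<lambda>j. restrict (\<gamma> j) V) ` {1..<L}) < card ?P"
    by (rule psubset_card_mono[OF fin])
  then have "L - 1 < card ?P" unfolding card_image[OF inj] by simp
  moreover have "card ?P = (\<Prod>v\<in>V. b v + 1)" using V by (simp add: card_PiE)
  ultimately show ?thesis by simp
qed

section \<open>Localization at a variable and adjunction of a pure power\<close>

lemma gseq_less:
  assumes "n < n'" shows "gseq H f n < gseq H f n'"
  using assms by (rule less_Suc_induct) auto

lemma gseq_mono: "mono (gseq H f)"
  by (metis gseq_less monoI order_le_less)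

text \<open>Setting the variable \<open>v\<close> to 1 drops the \<open>v\<close>-exponent and
  preserves inclusions. This is applied contrapositively: if \<open>N\<close> exceeds the bound for
  chains in \<open>V - {v}\<close>, two consecutive sampled localizations coincide.\<close>

lemma bounded_chain_localize:
  assumes ch: "bounded_chain V f L G" and g: "mono g" "g 1 = 1" "g N \<le> L"
    and strict: "\<And>n. n \<in> {1..<N} \<Longrightarrow>
      upset ((\<lambda>\<alpha>. \<alpha>(v := 0)) ` G (g n)) \<noteq> upset ((\<lambda>\<alpha>. \<alpha>(v := 0)) ` G (g (Suc n)))"
  shows "bounded_chain (V - {v}) (f \<circ> g) N (\<lambda>n. (\<lambda>\<alpha>. \<alpha>(v := 0)) ` G (g n))"
  unfolding bounded_chain_def
proof (intro conjI ballI)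
  fix j assume j: "j \<in> {1..N}"
  have le: "1 \<le> g j" "g j \<le> L"
    using j g monoD[OF g(1), of 1 j] monoD[OF g(1), of j N] by auto
  fix \<alpha> assume \<alpha>: "\<alpha> \<in> (\<lambda>\<alpha>. \<alpha>(v := 0)) ` G (g j)"
  show "\<forall>w. w \<notin> V - {v} \<longrightarrow> \<alpha> w = 0" "\<forall>w. \<alpha> w \<le> (f \<circ> g) j"
    using \<alpha> bounded_chain_generator[OF ch le] by auto
next
  fix n assume n: "n \<in> {1..<N}"
  have ord: "1 \<le> g n" "g n \<le> g (Suc n)" "g (Suc n) \<le> L"
    using n g monoD[OF g(1), of 1 n] monoD[OF g(1), of n "Suc n"] monoD[OF g(1), of "Suc n" N]
    by auto
  have sub: "G (g n) \<subseteq> upset (G (g (Suc n)))"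
    by (rule iffD1[OF upset_subset_iff bounded_chain_mono[OF ch ord]])
  have "(\<lambda>\<alpha>. \<alpha>(v := 0)) ` G (g n) \<subseteq> upset ((\<lambda>\<alpha>. \<alpha>(v := 0)) ` G (g (Suc n)))"
  proof (rule image_subsetI)
    fix \<alpha> assume "\<alpha> \<in> G (g n)"
    then obtain \<beta> where "\<beta> \<in> G (g (Suc n))" "\<beta> \<le> \<alpha>" using sub by (auto simp: upset_def)
    then show "\<alpha>(v := 0) \<in> upset ((\<lambda>\<alpha>. \<alpha>(v := 0)) ` G (g (Suc n)))"
      by (auto simp: upset_def le_fun_def)
  qed
  then show "upset ((\<lambda>\<alpha>. \<alpha>(v := 0)) ` G (g n)) \<subset> upset ((\<lambda>\<alpha>. \<alpha>(v := 0)) ` G (g (Suc n)))"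
    using strict[OF n] by (simp add: psubset_eq upset_subset_iff)
next
  show "(\<lambda>\<alpha>. \<alpha>(v := 0)) ` G (g 1) \<noteq> {}"
    using ch g(2) unfolding bounded_chain_def by simp
qed

text \<open>While the localizations at \<open>v\<close> are stationary, every new monomial has \<open>v\<close>-exponent below
  \<open>f p\<close>, so adding the pure power of \<open>v\<close> with exponent \<open>f p\<close> keeps the inclusions strict.\<close>

lemma bounded_chain_add_power:
  assumes ch: "bounded_chain V f L G" and f: "mono f" and v: "v \<in> V"
    and p: "1 \<le> p" and pM: "p + M \<le> L"
    and st: "upset ((\<lambda>\<alpha>. \<alpha>(v := 0)) ` G p) = upset ((\<lambda>\<alpha>. \<alpha>(v := 0)) ` G (p + M))"
  shows "bounded_chain V (shift p f) M (\<lambda>j. insert ((\<lambda>_. 0)(v := f p)) (G (p + j)))"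
  unfolding bounded_chain_def
proof (intro conjI ballI)
  fix j \<alpha> assume j: "j \<in> {1..M}" and \<alpha>: "\<alpha> \<in> insert ((\<lambda>_. 0)(v := f p)) (G (p + j))"
  have "1 \<le> p + j" "p + j \<le> L" using j pM by simp_all
  note gen = bounded_chain_generator[OF ch this]
  have "f p \<le> f (p + j)" using f by (simp add: monoD)
  then show "\<forall>w. w \<notin> V \<longrightarrow> \<alpha> w = 0" "\<forall>w. \<alpha> w \<le> shift p f j"
    using \<alpha> gen v unfolding shift_def by auto
next
  let ?P = "{(\<lambda>_. 0)(v := f p)}"
  fix j assume j: "j \<in> {1..<M}"
  then have pj: "p + j \<in> {1..<L}" using pM p by simp
  obtain \<gamma> where \<gamma>: "\<gamma> \<in> G (Suc (p + j))" "\<gamma> \<notin> upset (G (p + j))"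
    using bounded_chain_new[OF ch pj] .
  have sub: "upset (G p) \<subseteq> upset (G (p + j))"
    using bounded_chain_mono[OF ch] p pj by simp
  \<comment> \<open>If the \<open>v\<close>-exponent of \<open>\<gamma>\<close> were at least
    \<open>f p\<close>, stationarity would give a generator \<open>\<alpha>\<close> of
    \<open>G p\<close> dividing \<open>\<gamma>\<close> away from \<open>v\<close>. As
    \<open>\<alpha> v \<le> f p\<close>, it would divide \<open>\<gamma>\<close> altogether, which
    would then not be new.\<close>
  have "\<gamma> \<notin> upset ?P"
  proof
    assume "\<gamma> \<in> upset ?P"
    then have "(\<lambda>_. 0)(v := f p) \<le> \<gamma>" by (simp add: upset_def)
    from le_funD[OF this, of v] have big: "f p \<le> \<gamma> v" by simp
    have "upset (G (Suc (p + j))) \<subseteq> upset (G (p + M))"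
      using bounded_chain_mono[OF ch, of "Suc (p + j)" "p + M"] j pM by simp
    then obtain \<delta> where \<delta>: "\<delta> \<in> G (p + M)" "\<delta> \<le> \<gamma>"
      using \<gamma>(1) by (auto simp: upset_def)
    have "\<delta>(v := 0) \<in> upset ((\<lambda>\<alpha>. \<alpha>(v := 0)) ` G (p + M))"
      using \<delta>(1) by (auto simp: upset_def)
    then obtain \<alpha> where \<alpha>: "\<alpha> \<in> G p" "\<alpha>(v := 0) \<le> \<delta>(v := 0)"
      unfolding st[symmetric] by (auto simp: upset_def)
    have "\<alpha> v \<le> f p" using ch \<alpha>(1) p pM unfolding bounded_chain_def by auto
    moreover have "\<alpha> w \<le> \<gamma> w" if "w \<noteq> v" for w
      using le_funD[OF \<alpha>(2), of w] le_funD[OF \<delta>(2), of w] that by simp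
    ultimately have "\<alpha> w \<le> \<gamma> w" for w using big by (cases "w = v") auto
    then have "\<alpha> \<le> \<gamma>" by (rule le_funI)
    then have "\<gamma> \<in> upset (G p)" using \<alpha>(1) by (auto simp: upset_def)
    then show False using sub \<gamma>(2) by blast
  qed
  moreover have "\<gamma> \<in> upset (G (Suc (p + j)))" using \<gamma>(1) by (auto simp: upset_def)
  moreover have "upset (G (p + j)) \<subseteq> upset (G (Suc (p + j)))"
    using bounded_chain_mono[OF ch] p pj by simp
  ultimately show "upset (insert ((\<lambda>_. 0)(v := f p)) (G (p + j)))
      \<subset> upset (insert ((\<lambda>_. 0)(v := f p)) (G (p + Suc j)))"
    using \<gamma>(2) upset_insert[of "(\<lambda>_. 0)(v := f p)" "G (p + j)"]
      upset_insert[of "(\<lambda>_. 0)(v := f p)" "G (p + Suc j)"] unfolding add_Suc_right by blast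
qed simp

section \<open>Length bounds by \<open>calBk\<close> and \<open>calB\<close>\<close>

text \<open>The list \<open>vs\<close> records the variables with a pure power already in the first
  ideal, and \<open>map b vs\<close> is the tuple of their exponents. The induction is on the number
  of remaining variables; the bound for one variable fewer enters as the assumption
  \<open>IH\<close>.\<close>

lemma bounded_chain_length_le_calBk:
  fixes V :: "'v set"
  assumes V: "finite V" "V \<noteq> {}"
    and IH: "\<And>v f L G. \<lbrakk>v \<in> V; mono f; bounded_chain (V - {v}) f L G\<rbrakk> \<Longrightarrow> L \<le> calB (card V - 1) f"
    and "mono f" "bounded_chain V f L G" "distinct vs" "set vs \<subseteq> V"
    and "\<And>v. v \<in> set vs \<Longrightarrow> (\<lambda>_. 0)(v := b v) \<in> upset (G 1)"
  shows "L \<le> calBk (card V) (length vs) f (map b vs)"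
  using assms(4-)
proof (induction "card V - length vs" arbitrary: f L G vs b)
  case 0
  have "length vs = card (set vs)" using 0 by (simp add: distinct_card)
  then have "set vs = V" using 0 V card_seteq[of V "set vs"] by simp
  then have "(\<Prod>b\<leftarrow>map b vs. b + 1) = (\<Prod>v\<in>V. b v + 1)"
    using prod.distinct_set_conv_list[OF 0(4), of "\<lambda>v. b v + 1"] by (simp add: comp_def)
  moreover have "L \<le> (\<Prod>v\<in>V. b v + 1)"
    using bounded_chain_length_le_box[OF V 0(3)] 0(6) \<open>set vs = V\<close> by blast
  ultimately show ?case using 0 by (simp add: calBk.simps)
next
  case (Suc l)
  let ?H = "\<lambda>f' c. calBk (card V) (length vs + 1) f' (map b vs @ [c])"
  define g where "g = gseq ?H f"
  \<comment> \<open>One more than the length of any chain in \<open>V - {v}\<close> bounded by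
    \<open>f \<circ> g\<close>, so among the localizations at \<open>g 1, ..., g N\<close> some two
    consecutive ones agree.\<close>
  define N where "N = calB (card V - 1) (f \<circ> g) + 1"
  have calBk: "calBk (card V) (length vs) f (map b vs) = g N"
    using Suc(2) by (auto simp only: calBk.simps[of "card V" "length vs" f "map b vs"]
        g_def N_def Let_def if_False split: if_split)
  have "set vs \<noteq> V" using Suc(2) distinct_card[OF Suc(5)] by auto
  then obtain v where v: "v \<in> V" "v \<notin> set vs" using Suc by blast
  have g: "mono g" "g 1 = 1" by (simp_all add: g_def gseq_mono)
  show ?case
  proof (rule ccontr)
    assume "\<not> ?thesis"
    then have gN: "g N \<le> L" using calBk by simp
    have "\<not> bounded_chain (V - {v}) (f \<circ> g) N (\<lambda>n. (\<lambda>\<alpha>. \<alpha>(v := 0)) ` G (g n))"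
    proof
      assume "bounded_chain (V - {v}) (f \<circ> g) N (\<lambda>n. (\<lambda>\<alpha>. \<alpha>(v := 0)) ` G (g n))"
      moreover have "mono (f \<circ> g)" using g(1) Suc(3) by (intro monoI) (simp add: monoD)
      ultimately have "N \<le> calB (card V - 1) (f \<circ> g)" using IH[OF v(1)] by blast
      then show False by (simp add: N_def)
    qed
    then obtain n where n: "n \<in> {1..<N}" and st:
      "upset ((\<lambda>\<alpha>. \<alpha>(v := 0)) ` G (g n)) = upset ((\<lambda>\<alpha>. \<alpha>(v := 0)) ` G (g (Suc n)))"
      using bounded_chain_localize[OF Suc(4) g gN] by blast
    \<comment> \<open>Because of the summand 1 in \<open>gseq\<close>, the gap \<open>M\<close>
      exceeds the bound for chains with one more pure power. A chain of that kind with
      \<open>M\<close> members is therefore a contradiction.\<close>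
    define M where "M = 1 + ?H (shift (g n) f) (f (g n))"
    have gSuc: "g (Suc n) = g n + M" using n by (simp add: g_def M_def)
    have gn: "1 \<le> g n" using monoD[OF g(1), of 1 n] n g(2) by simp
    have gM: "g n + M \<le> L" using monoD[OF g(1), of "Suc n" N] n gN gSuc by simp
    let ?b = "b(v := f (g n))"
    \<comment> \<open>Member \<open>j \<ge> 1\<close> comes from index \<open>g n + j\<close>, hence
      the bound \<open>shift (g n) f\<close>; monotonicity of \<open>f\<close> keeps the added
      exponent \<open>f (g n)\<close> within it.\<close>
    let ?G = "\<lambda>j. insert ((\<lambda>_. 0)(v := f (g n))) (G (g n + j))"
    have chain: "bounded_chain V (shift (g n) f) M ?G"
      by (rule bounded_chain_add_power[OF Suc(4,3) v(1) gn gM]) (use st gSuc in simp)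
    have power: "(\<lambda>_. 0)(w := ?b w) \<in> upset (?G 1)" if "w \<in> set (vs @ [v])" for w
    proof (cases "w = v")
      case True
      then show ?thesis by (auto simp: upset_def)
    next
      case False
      then have "(\<lambda>_. 0)(w := b w) \<in> upset (G 1)" using Suc(7) that by simp
      then have "(\<lambda>_. 0)(w := b w) \<in> upset (G (g n + 1))"
        using bounded_chain_mono[OF Suc(4), of 1 "g n + 1"] gM by (auto simp: M_def)
      then show ?thesis using False by (auto simp: upset_def)
    qed
    have "mono (shift (g n) f)" using Suc(3) by (simp add: monotone_on_def shift_def)
    moreover have "l = card V - length (vs @ [v])" "distinct (vs @ [v])" "set (vs @ [v]) \<subseteq> V"
      using Suc(2,5,6) v by simp_all
    ultimately have "M \<le> calBk (card V) (length (vs @ [v])) (shift (g n) f) (map ?b (vs @ [v]))"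
      using Suc(1) chain power by blast
    moreover have "map ?b vs = map b vs" using v by simp
    ultimately show False by (simp add: M_def)
  qed
qed

text \<open>Strong induction on the number of variables. In one variable any generator in
  \<open>G 1\<close> is itself a pure power with exponent at most \<open>f 1\<close>, so the box
  bound applies. Otherwise one starts with no pure powers, that is, with the empty list.\<close>

theorem bounded_chain_length_le_calB:
  fixes V :: "'v set"
  assumes "finite V" "V \<noteq> {}" "mono f" "bounded_chain V f L G"
  shows "L \<le> calB (card V) f"
  using assms
proof (induction "card V" arbitrary: V f L G rule: less_induct)
  case less
  show ?case
  proof (cases "card V = 1")
    case True
    then obtain v where v: "V = {v}" by (auto simp: card_1_singleton_iff)
    show ?thesis
    proof (cases "L = 0")
      \<comment> \<open>Only for \<open>L \<ge> 1\<close> does the chain condition bound the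
        generators of \<open>G 1\<close>.\<close>
      case False
      then obtain \<alpha> where \<alpha>: "\<alpha> \<in> G 1" "\<forall>w. w \<notin> V \<longrightarrow> \<alpha> w = 0" "\<forall>v. \<alpha> v \<le> f 1"
        using less(5) unfolding bounded_chain_def by fastforce
      have "\<alpha> \<le> (\<lambda>_. 0)(v := \<alpha> v)" using \<alpha>(2) v by (auto simp: le_fun_def)
      then have "L \<le> (\<Prod>v\<in>V. \<alpha> v + 1)"
        using less v \<alpha>(1) by (intro bounded_chain_length_le_box) (auto simp: upset_def)
      also have "\<dots> \<le> f 1 + 1" using v \<alpha>(3) by simp
      finally show ?thesis using v by (simp add: calB.simps)
    qed simp
  next
    case False
    then have card: "card V > 1" using card_0_eq[OF less(2)] less(3) by linarith
    have "L \<le> calBk (card V) (length ([] :: 'v list)) f (map (\<lambda>_. 0) ([] :: 'v list))"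
    proof (rule bounded_chain_length_le_calBk[where G = G])
      fix v f L G assume v: "v \<in> V" "mono f" "bounded_chain (V - {v}) f L G"
      have "card (V - {v}) = card V - 1" using v less(2) by simp
      moreover from this have "V - {v} \<noteq> {}" using card by (metis card.empty not_less0 zero_less_diff)
      ultimately show "L \<le> calB (card V - 1) f"
        using less(1)[of "V - {v}" f L G] less(2) v card by simp
    qed (use less(2-5) in simp_all)
    then show ?thesis using card by (simp add: calB.simps)
  qed
qed


section \<open>Leading monomials, S-polynomials and reductions\<close>

text \<open>Justifies the definite description in \<open>lm\<close>: a finite non-empty set has a
  maximum under a total order, unique by antisymmetry.\<close>

lemma lm_greatest:
  assumes "admissible le" "f \<noteq> 0"
  shows "lm le f \<in> Poly_Mapping.keys f" "\<beta> \<in> Poly_Mapping.keys f \<Longrightarrow> (\<beta>, lm le f) \<in> le"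
proof -
  have le: "refl le" "trans le" "antisym le" "total le"
    using assms(1) unfolding admissible_def order_on_defs by auto
  have max: "\<exists>\<alpha>\<in>A. \<forall>\<beta>\<in>A. (\<beta>, \<alpha>) \<in> le" if "finite A" "A \<noteq> {}" for A
    using that
  proof (induction rule: finite_ne_induct)
    case (singleton x)
    then show ?case using le(1) by (auto dest: reflD)
  next
    case (insert x A)
    then obtain \<alpha> where \<alpha>: "\<alpha> \<in> A" "\<forall>\<beta>\<in>A. (\<beta>, \<alpha>) \<in> le" by blast
    show ?case
    proof (cases "(x, \<alpha>) \<in> le")
      case True
      then show ?thesis using \<alpha> by blast
    next
      case False
      then have "(\<alpha>, x) \<in> le" using le(1,4) unfolding total_on_def by (metis UNIV_I reflD)
      then show ?thesis using \<alpha> le(1,2) by (metis insert_iff reflD transD)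
    qed
  qed
  have "\<exists>!\<alpha>. \<alpha> \<in> Poly_Mapping.keys f \<and> (\<forall>\<beta>\<in>Poly_Mapping.keys f. (\<beta>, \<alpha>) \<in> le)"
  proof (rule ex_ex1I)
    show "\<exists>\<alpha>. \<alpha> \<in> Poly_Mapping.keys f \<and> (\<forall>\<beta>\<in>Poly_Mapping.keys f. (\<beta>, \<alpha>) \<in> le)"
      using max[of "Poly_Mapping.keys f"] assms(2) by auto
  qed (use le(3) in \<open>auto dest: antisymD\<close>)
  from theI'[OF this] show "lm le f \<in> Poly_Mapping.keys f"
    "\<beta> \<in> Poly_Mapping.keys f \<Longrightarrow> (\<beta>, lm le f) \<in> le"
    unfolding lm_def by auto
qed

lemma monom_deg_add: "monom_deg (\<alpha> + \<beta>) = monom_deg \<alpha> + monom_deg \<beta>"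
  by (simp add: monom_deg_def sum.distrib)

lemma le_monom_deg: "\<alpha> $ i \<le> monom_deg \<alpha>"
  unfolding monom_deg_def by (rule member_le_sum) auto

lemma monom_deg_lcm_le: "monom_deg (monom_lcm \<alpha> \<beta>) \<le> monom_deg \<alpha> + monom_deg \<beta>"
  unfolding monom_deg_def monom_lcm_def sum.distrib[symmetric] by (rule sum_mono) simp

lemma monom_lcm_commute: "monom_lcm \<alpha> \<beta> = monom_lcm \<beta> \<alpha>"
  by (simp add: monom_lcm_def max.commute)

lemma monom_lcm_minus_add: "(monom_lcm \<alpha> \<beta> - \<alpha>) + \<alpha> = monom_lcm \<alpha> \<beta>"
  by (simp add: monom_lcm_def vec_eq_iff)

text \<open>Links divisibility to the pointwise order behind \<open>upset\<close>; the cofactor is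
  the truncated difference, which is exact here.\<close>

lemma monom_dvd_iff: "monom_dvd \<alpha> \<beta> \<longleftrightarrow> ($) \<alpha> \<le> ($) \<beta>"
proof
  assume "($) \<alpha> \<le> ($) \<beta>"
  then have "\<beta> = \<alpha> + (\<beta> - \<alpha>)" by (simp add: vec_eq_iff le_fun_def)
  then show "monom_dvd \<alpha> \<beta>" unfolding monom_dvd_def by blast
qed (auto simp: monom_dvd_def le_fun_def)

lemma monom_deg_keys_le_lm:
  assumes "admissible le" "graded le" "\<kappa> \<in> Poly_Mapping.keys f"
  shows "monom_deg \<kappa> \<le> monom_deg (lm le f)"
proof -
  have "f \<noteq> 0" using assms(3) by auto
  then show ?thesis using lm_greatest(2)[OF assms(1)] assms(2,3) unfolding graded_def by blast
qed

text \<open>The cofactor of \<open>h\<close> moves \<open>lm le h\<close> to the lcm. In a graded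
  ordering \<open>lm le h\<close> has the largest degree in \<open>h\<close>, so neither summand
  exceeds the degree of the lcm.\<close>

lemma monom_deg_keys_spoly:
  fixes f g :: "('n::finite, 'a::field) mpoly"
  assumes le: "admissible le" "graded le"
    and \<kappa>: "\<kappa> \<in> Poly_Mapping.keys (spoly le f g)"
  shows "monom_deg \<kappa> \<le> monom_deg (lm le f) + monom_deg (lm le g)"
proof -
  have *: "monom_deg \<kappa> \<le> monom_deg (monom_lcm (lm le h) \<beta>)"
    if \<kappa>: "\<kappa> \<in> Poly_Mapping.keys (Poly_Mapping.single (monom_lcm (lm le h) \<beta> - lm le h) c * h)"
    for h :: "('n, 'a) mpoly" and \<beta> c
  proof -
    let ?m = "monom_lcm (lm le h) \<beta> - lm le h"
    obtain \<mu> where \<mu>: "\<mu> \<in> Poly_Mapping.keys h" "\<kappa> = ?m + \<mu>"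
      using subsetD[OF keys_mult \<kappa>] by (auto split: if_splits)
    have "monom_deg \<kappa> \<le> monom_deg (?m + lm le h)"
      using monom_deg_keys_le_lm[OF le \<mu>(1)] \<mu>(2) by (simp add: monom_deg_add)
    then show ?thesis by (simp add: monom_lcm_minus_add)
  qed
  from subsetD[OF keys_diff \<kappa>[unfolded spoly_def Let_def]]
  have "monom_deg \<kappa> \<le> monom_deg (monom_lcm (lm le f) (lm le g))"
    using *[of f "lm le g"] *[of g "lm le f"] by (auto simp: monom_lcm_commute[of "lm le g"])
  then show ?thesis using monom_deg_lcm_le order_trans by blast
qed

text \<open>A non-zero remainder is among the polynomials whose leading monomials are dominated by
  \<open>lm le f\<close>; this forces \<open>f \<noteq> 0\<close>. The first conclusion lets a
  degree bound on the support of \<open>f\<close> apply to \<open>lm le f\<close>.\<close>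

lemma is_reduction_monom_deg_lm:
  assumes le: "admissible le" "graded le" and r: "is_reduction le B f r" "r \<noteq> 0"
  shows "lm le f \<in> Poly_Mapping.keys f" "monom_deg (lm le r) \<le> monom_deg (lm le f)"
proof -
  obtain a where a: "let L = lm le ` (insert r ((\<lambda>b. a b * b) ` B) - {0})
           in if f = 0 then L = {} else lm le f \<in> L \<and> (\<forall>\<mu>\<in>L. (\<mu>, lm le f) \<in> le)"
    using r(1) unfolding is_reduction_def by blast
  have L: "lm le r \<in> lm le ` (insert r ((\<lambda>b. a b * b) ` B) - {0})" using r(2) by blast
  have "f \<noteq> 0"
  proof
    assume "f = 0"
    with a have "lm le ` (insert r ((\<lambda>b. a b * b) ` B) - {0}) = {}" by (simp only: Let_def simp_thms if_True)
    with L show False by blast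
  qed
  then show "lm le f \<in> Poly_Mapping.keys f" using lm_greatest(1)[OF le(1)] by blast
  have "(lm le r, lm le f) \<in> le" using a r(2) \<open>f \<noteq> 0\<close> by (simp add: Let_def)
  then show "monom_deg (lm le r) \<le> monom_deg (lm le f)" using le(2) unfolding graded_def by blast
qed

lemma is_reduction_not_dvd:
  assumes "admissible le" "is_reduction le B f r" "r \<noteq> 0" "b \<in> B"
  shows "\<not> monom_dvd (lm le b) (lm le r)"
  using assms lm_greatest(1)[of le r] unfolding is_reduction_def by blast

text \<open>The generators are single terms, so each monomial of a combination is a multiple of the
  monomial of one of them.\<close>

lemma keys_ideal_gen_LT:
  assumes "p \<in> ideal_gen (LT le B)" "\<kappa> \<in> Poly_Mapping.keys p"
  obtains b where "b \<in> B" "monom_dvd (lm le b) \<kappa>"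
proof -
  obtain T c where T: "T \<subseteq> LT le B" and p: "p = (\<Sum>t\<in>T. c t * t)"
    using assms(1) unfolding ideal_gen_explicit by blast
  obtain t where t: "t \<in> T" "\<kappa> \<in> Poly_Mapping.keys (c t * t)"
    using subsetD[OF keys_sum assms(2)[unfolded p]] by blast
  then obtain b where b: "b \<in> B" "t = lt le b" using T unfolding LT_def by blast
  obtain \<mu> \<nu> where \<nu>: "\<nu> \<in> Poly_Mapping.keys t" "\<kappa> = \<mu> + \<nu>"
    using subsetD[OF keys_mult t(2)] by blast
  then have "\<nu> = lm le b" using b(2) unfolding lt_def by (simp split: if_splits)
  then have "monom_dvd (lm le b) \<kappa>" using \<nu>(2) unfolding monom_dvd_def by (metis add.commute)
  with b(1) that show ?thesis by blast
qed

section \<open>Runs of Buchberger's algorithm\<close>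

text \<open>Before termination some non-zero reduction is added, whose support avoids all multiples
  of the old leading monomials. This yields strictness both for the ideals and for the exponent
  sets.\<close>

lemma buchberger_run_step:
  assumes run: "buchberger_run le F B r" and i: "i < r" and le: "admissible le"
  shows "B i \<subseteq> B (i + 1)"
    and "\<exists>h\<in>B (i + 1). h \<noteq> 0 \<and> (\<forall>b\<in>B i. \<not> monom_dvd (lm le b) (lm le h))"
proof -
  obtain S where S: "is_spoly_reductions le (B i) S" "B (i + 1) = B i \<union> S"
    using run i unfolding buchberger_run_def by (meson less_imp_le)
  show "B i \<subseteq> B (i + 1)" using S by blast
  have "B (i + 1) \<noteq> B i" using run i unfolding buchberger_run_def by blast
  then obtain h where h: "h \<in> S" using S(2) by blast
  then obtain b c where "h \<noteq> 0" "is_reduction le (B i) (spoly le b c) h"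
    using S(1) unfolding is_spoly_reductions_def by auto
  then show "\<exists>h\<in>B (i + 1). h \<noteq> 0 \<and> (\<forall>b\<in>B i. \<not> monom_dvd (lm le b) (lm le h))"
    using is_reduction_not_dvd[OF le] h S(2) by blast
qed

lemma buchberger_run_monom_deg_lm:
  assumes run: "buchberger_run le F B r" and le: "admissible le" "graded le"
    and F: "\<And>f. f \<in> F \<Longrightarrow> monom_deg (lm le f) \<le> d"
    and "i \<le> r" "b \<in> B i"
  shows "monom_deg (lm le b) \<le> 2 ^ i * d"
  using assms(5,6)
proof (induction i arbitrary: b)
  case 0
  then show ?case using run F unfolding buchberger_run_def by simp
next
  case (Suc i)
  obtain S where S: "is_spoly_reductions le (B i) S" "B (Suc i) = B i \<union> S"
    using run Suc(2) unfolding buchberger_run_def by (metis Suc_eq_plus1 Suc_leD)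
  consider "b \<in> B i" | "b \<in> S" using S Suc by blast
  then show ?case
  proof cases
    case 1
    then show ?thesis using Suc(1)[of b] Suc(2) by simp
  next
    case 2
    then obtain p q where pq: "p \<in> B i" "q \<in> B i" "b \<noteq> 0" "is_reduction le (B i) (spoly le p q) b"
      using S(1) unfolding is_spoly_reductions_def by auto
    \<comment> \<open>Reduction does not raise the degree of the leading monomial, and that of an
      S-polynomial is at most the sum of the two given ones, so one step at most doubles the
      bound.\<close>
    have "monom_deg (lm le b) \<le> monom_deg (lm le p) + monom_deg (lm le q)"
      using is_reduction_monom_deg_lm[OF le pq(4,3)] monom_deg_keys_spoly[OF le] order_trans by blast
    then show ?thesis using Suc(1)[OF _ pq(1)] Suc(1)[OF _ pq(2)] Suc(2) by simp
  qed
qed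

theorem corollary4p4:
  fixes le :: "'n::finite monom rel"
    and F :: "('n, 'a::field) mpoly set"
    and B :: "nat \<Rightarrow> ('n, 'a) mpoly set"
    and d r :: nat
  assumes "admissible le" and "graded le"
    and "finite F" and "\<forall>f\<in>F. f \<noteq> 0"
    and "d \<ge> 1" and "\<forall>f\<in>F. total_degree f \<le> d"
    and "buchberger_run le F B r"
  shows "(\<forall>i<r. ideal_gen (LT le (B i)) \<subset> ideal_gen (LT le (B (i + 1)))) \<and>
         r + 1 \<le> calB CARD('n) (\<lambda>n. 3 ^ n * d)"
proof
  note le = assms(1,2) and run = assms(7)
  note step = buchberger_run_step[OF run _ le(1)]
  show "\<forall>i<r. ideal_gen (LT le (B i)) \<subset> ideal_gen (LT le (B (i + 1)))"
  proof (intro allI impI)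
    fix i assume i: "i < r"
    have sub: "ideal_gen (LT le (B i)) \<subseteq> ideal_gen (LT le (B (i + 1)))"
      unfolding ideal_gen_def LT_def
      by (intro module.span_mono[OF module_mult] image_mono step(1) i)
    \<comment> \<open>The term \<open>lt le h\<close> witnesses strictness: it lies in the new
      ideal, but its monomial is a multiple of no leading monomial of \<open>B i\<close>.\<close>
    obtain h where h: "h \<in> B (i + 1)" "h \<noteq> 0" "\<forall>b\<in>B i. \<not> monom_dvd (lm le b) (lm le h)"
      using step(2)[OF i] by blast
    have "lt le h \<in> ideal_gen (LT le (B (i + 1)))"
      unfolding ideal_gen_def LT_def using h(1) by (intro module.span_base[OF module_mult]) simp
    moreover have "lm le h \<in> Poly_Mapping.keys (lt le h)"
      using lm_greatest(1)[OF le(1) h(2)] by (simp add: lt_def in_keys_iff)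
    then have "lt le h \<notin> ideal_gen (LT le (B i))"
      using h(3) keys_ideal_gen_LT by metis
    ultimately show "ideal_gen (LT le (B i)) \<subset> ideal_gen (LT le (B (i + 1)))"
      using sub by blast
  qed
  define \<phi> :: "nat \<Rightarrow> nat" where "\<phi> = (\<lambda>n. 3 ^ n * d)"
  \<comment> \<open>The run is indexed from 0 and chains from 1, hence \<open>j - 1\<close>.\<close>
  define G where "G j = (\<lambda>b. ($) (lm le b)) ` B (j - 1)" for j
  have "mono \<phi>" unfolding \<phi>_def by (intro monoI mult_right_mono power_increasing) auto
  have degF: "monom_deg (lm le f) \<le> d" if "f \<in> F" for f
  proof -
    have "monom_deg (lm le f) \<le> total_degree f"
      unfolding total_degree_def using lm_greatest(1)[OF le(1)] that assms(4) by (intro Max_ge) auto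
    then show ?thesis using assms(6) that by fastforce
  qed
  have "\<exists>G. bounded_chain (UNIV :: 'n set) \<phi> (r + 1) G"
  proof (cases "F = {}")
    \<comment> \<open>Here every \<open>G j\<close> with \<open>j \<le> r + 1\<close> is empty,
      which chains forbid at index 1. The algorithm stops at once, so \<open>r = 0\<close>, and the
      one-member chain of the unit ideal has the right length.\<close>
    case True
    then have "B 0 = {}" "B 1 = {}"
      using run unfolding buchberger_run_def is_spoly_reductions_def by auto
    then have "r = 0" using run unfolding buchberger_run_def by (metis One_nat_def Suc_eq_plus1 gr0I)
    then have "bounded_chain (UNIV :: 'n set) \<phi> (r + 1) (\<lambda>_. {\<lambda>_. 0})"
      by (simp add: bounded_chain_def)
    then show ?thesis by blast
  next
    case False
    have "bounded_chain (UNIV :: 'n set) \<phi> (r + 1) G"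
      unfolding bounded_chain_def
    proof (intro conjI ballI)
      fix j \<alpha> assume j: "j \<in> {1..r + 1}" and "\<alpha> \<in> G j"
      then obtain b where b: "b \<in> B (j - 1)" "\<alpha> = ($) (lm le b)" by (auto simp: G_def)
      have "monom_deg (lm le b) \<le> 2 ^ (j - 1) * d"
        by (rule buchberger_run_monom_deg_lm[OF run le degF _ b(1)]) (use j in auto)
      also have "(2::nat) ^ (j - 1) \<le> 3 ^ (j - 1)" by (rule power_mono) auto
      also have "(3::nat) ^ (j - 1) \<le> 3 ^ j" by (rule power_increasing) auto
      finally have "monom_deg (lm le b) \<le> \<phi> j" by (simp add: \<phi>_def)
      then show "\<forall>v. \<alpha> v \<le> \<phi> j" using le_monom_deg order_trans unfolding b(2) by blast
    next
      fix j assume "j \<in> {1..<r + 1}"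
      then obtain i where i: "j = Suc i" "i < r" by (cases j) auto
      obtain h where h: "h \<in> B (i + 1)" "\<forall>b\<in>B i. \<not> monom_dvd (lm le b) (lm le h)"
        using step(2)[OF i(2)] by blast
      have "upset (G j) \<subseteq> upset (G (Suc j))"
        using step(1)[OF i(2)] unfolding upset_def G_def i(1) by fastforce
      moreover have "($) (lm le h) \<in> upset (G (Suc j))"
        using h(1) unfolding upset_def G_def i(1) by auto
      moreover have "($) (lm le h) \<notin> upset (G j)"
        using h(2) unfolding upset_def G_def i(1) monom_dvd_iff by auto
      ultimately show "upset (G j) \<subset> upset (G (Suc j))" by blast
    next
      show "G 1 \<noteq> {}" using False run by (simp add: G_def buchberger_run_def)
    qed auto
    then show ?thesis by blast
  qed
  then show "r + 1 \<le> calB CARD('n) (\<lambda>n. 3 ^ n * d)"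
    using bounded_chain_length_le_calB[OF finite UNIV_not_empty \<open>mono \<phi>\<close>]
    unfolding \<phi>_def by blast
qed

end
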